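(* Let $\{(\bm{x}^{(k)},\alpha^{(k)})\}_{k\ge0}$ be generated by the prox-linear Dinkelbach scheme described in the context, and suppose that assumptions (i)--(iv) of the context hold. Let $\overline\nu<\infty$ be a constant with $\|\bm{x}\|_q^p\le\overline\nu$ for all $\bm{x}\in\Omega\cap\mathcal{F}$. Then, for every $k\ge0$, $$\Delta_k\ge\frac{\beta-\alpha^{(k)}L_s}{2}\|\bm{x}^{(k+1)}-\bm{x}^{(k)}\|_2^2\ge\frac{\beta-\overline\alpha L_s}{2}\|\bm{x}^{(k+1)}-\bm{x}^{(k)}\|_2^2\ge0.$$ Consequently, $$\alpha^{(k)}-\alpha^{(k+1)}=\frac{\Delta_k}{\|\bm{x}^{(k+1)}\|_q^p}\ge\frac{\beta-\overline\alpha L_s}{2\overline\nu}\|\bm{x}^{(k+1)}-\bm{x}^{(k)}\|_2^2.$$ Hence $\{\alpha^{(k)}\}$ is monotonically decreasing (i.e. $\alpha^{(k+1)}\le\alpha^{(k)}$) and convergent, and $\|\bm{x}^{(k+1)}-\bm{x}^{(k)}\|_2\to0$.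
   Context: Let $\bm{A}\in\mathbb{R}^{m\times n}$, $\bm{b}\in\mathbb{R}^m$, $\mathcal{F}:=\{\bm{x}\in\mathbb{R}^n:\bm{A}\bm{x}=\bm{b}\}$, $\|\bm{x}\|_r:=(\sum_i|x_i|^r)^{1/r}$ for $0<r<\infty$, $s(\bm{x}):=\|\bm{x}\|_q^p$, and $h(\bm{x}):=\|\bm{x}\|_p^p+I_{\mathcal{F}}(\bm{x})$, where $I_{\mathcal{F}}$ is $0$ on $\mathcal{F}$ and $+\infty$ elsewhere. Scheme: start from $\bm{x}^{(0)}\in\mathcal{F}$ and $\alpha^{(0)}:=\|\bm{x}^{(0)}\|_p^p/\|\bm{x}^{(0)}\|_q^p$, with proximal parameter $\beta>0$. For $k=0,1,2,\dots$ set $\bm{c}^{(k)}:=\alpha^{(k)}\nabla s(\bm{x}^{(k)})=\alpha^{(k)}p\|\bm{x}^{(k)}\|_q^{p-q}\operatorname{sign}(\bm{x}^{(k)})\odot|\bm{x}^{(k)}|^{q-1}$ (entrywise operations), choose $$\bm{x}^{(k+1)}\in\arg\min_{\bm{x}\in\mathbb{R}^n}\left\{h(\bm{x})-\langle\bm{c}^{(k)},\bm{x}\rangle+\tfrac\beta2\|\bm{x}-\bm{x}^{(k)}\|_2^2\right\},$$ and set $\Delta_k:=\alpha^{(k)}\|\bm{x}^{(k+1)}\|_q^p-\|\bm{x}^{(k+1)}\|_p^p$, $\alpha^{(k+1)}:=\|\bm{x}^{(k+1)}\|_p^p/\|\bm{x}^{(k+1)}\|_q^p$. Assumptions: (i)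 $\mathcal{F}\ne\emptyset$, $0<p\le1$, $q>1$, $\bm{b}\ne\bm{0}$, and $\bm{A}$ has full row rank. (ii) The sequence $\{\bm{x}^{(k)}\}$ is bounded. (iii) There exist a compact set $\Omega\subset\mathbb{R}^n$ and an open convex set $\mathcal{U}\subset\mathbb{R}^n$ with $\Omega\subset\mathcal{U}$, $\bm{x}^{(k)}\in\Omega\cap\mathcal{F}$ for all $k$, and $\nabla s$ is $L_s$-Lipschitz on $\mathcal{U}$: $\|\nabla s(\bm{x})-\nabla s(\bm{y})\|_2\le L_s\|\bm{x}-\bm{y}\|_2$ for all $\bm{x},\bm{y}\in\mathcal{U}$. (iv) $\beta>\overline\alpha L_s$, where $\overline\alpha:=n^{1-p/q}$. *)

theory Defs
  imports "HOL-Analysis.Analysis"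
begin

text \<open>The \<open>\<ell>\<^sub>r\<close> (quasi-)norm, for \<open>0 < r\<close>; for \<open>r < 1\<close> it is not a norm.\<close>
definition lr :: "real \<Rightarrow> real ^ 'n \<Rightarrow> real"
  where "lr r x = (\<Sum>i\<in>UNIV. \<bar>x $ i\<bar> powr r) powr (1 / r)"

definition feasible :: "real ^ 'n ^ 'm \<Rightarrow> real ^ 'm \<Rightarrow> (real ^ 'n) set"
  where "feasible A b = {x. A *v x = b}"

definition indicator_fun :: "'a set \<Rightarrow> 'a \<Rightarrow> ereal"
  where "indicator_fun S x = (if x \<in> S then 0 else \<infinity>)"

definition s_fun :: "real \<Rightarrow> real \<Rightarrow> real ^ 'n \<Rightarrow> real"
  where "s_fun p q x = lr q x powr p"

definition h_fun :: "real ^ 'n ^ 'm \<Rightarrow> real ^ 'm \<Rightarrow> real \<Rightarrow> real ^ 'n \<Rightarrow> ereal"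
  where "h_fun A b p x = ereal (lr p x powr p) + indicator_fun (feasible A b) x"

text \<open>The gradient is unspecified at points of non-differentiability. For \<^term>\<open>s_fun p q\<close>
  with \<open>0 < p \<le> 1 < q\<close> the only such point is the origin; the closed form elsewhere is
  \<open>gradient_s_fun\<close> below.\<close>
definition gradient :: "('a::real_inner \<Rightarrow> real) \<Rightarrow> 'a \<Rightarrow> 'a"
  where "gradient f x = (THE d. GDERIV f x :> d)"

definition c_vec :: "real \<Rightarrow> real \<Rightarrow> (nat \<Rightarrow> real ^ 'n) \<Rightarrow> (nat \<Rightarrow> real) \<Rightarrow> nat \<Rightarrow> real ^ 'n"
  where "c_vec p q x \<alpha> k = \<alpha> k *\<^sub>R gradient (s_fun p q) (x k)"

definition subproblem ::
  "real ^ 'n ^ 'm \<Rightarrow> real ^ 'm \<Rightarrow> real \<Rightarrow> real \<Rightarrow> real ^ 'n \<Rightarrow> real ^ 'n \<Rightarrow> real ^ 'n \<Rightarrow> ereal"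
  where "subproblem A b p \<beta> c y z =
    h_fun A b p z - ereal (c \<bullet> z) + ereal (\<beta> / 2 * (norm (z - y))\<^sup>2)"

text \<open>The argmin need not be a singleton, so the scheme is a relation on pairs of sequences.\<close>
definition prox_linear_dinkelbach ::
  "real ^ 'n ^ 'm \<Rightarrow> real ^ 'm \<Rightarrow> real \<Rightarrow> real \<Rightarrow> real \<Rightarrow>
    (nat \<Rightarrow> real ^ 'n) \<Rightarrow> (nat \<Rightarrow> real) \<Rightarrow> bool"
  where "prox_linear_dinkelbach A b p q \<beta> x \<alpha> \<longleftrightarrow>
    x 0 \<in> feasible A b \<and>
    \<alpha> 0 = lr p (x 0) powr p / lr q (x 0) powr p \<and>
    (\<forall>k. is_arg_min (subproblem A b p \<beta> (c_vec p q x \<alpha> k) (x k)) (\<lambda>_. True) (x (Suc k)) \<and>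
         \<alpha> (Suc k) = lr p (x (Suc k)) powr p / lr q (x (Suc k)) powr p)"

definition Delta :: "real \<Rightarrow> real \<Rightarrow> (nat \<Rightarrow> real ^ 'n) \<Rightarrow> (nat \<Rightarrow> real) \<Rightarrow> nat \<Rightarrow> real"
  where "Delta p q x \<alpha> k = \<alpha> k * lr q (x (Suc k)) powr p - lr p (x (Suc k)) powr p"

definition alpha_bar :: "nat \<Rightarrow> real \<Rightarrow> real \<Rightarrow> real"
  where "alpha_bar n p q = real n powr (1 - p / q)"

lemma gradient_eqI:
  assumes "GDERIV f x :> d"
  shows "gradient f x = d"
  unfolding gradient_def
proof (rule the_equality)
  show "GDERIV f x :> d" by (fact assms)
next
  fix e assume "GDERIV f x :> e"
  then have "(\<lambda>h. h \<bullet> e) = (\<lambda>h. h \<bullet> d)"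
    using assms has_derivative_unique unfolding gderiv_def by blast
  then show "e = d"
    by (metis inner_commute vector_eq_rdot)
qed

lemma abs_powr_has_derivative:
  fixes t q :: real
  assumes "q > 1"
  shows "((\<lambda>t. \<bar>t\<bar> powr q) has_real_derivative q * sgn t * \<bar>t\<bar> powr (q - 1)) (at t)"
proof -
  consider "t > 0" | "t < 0" | "t = 0" by linarith
  then show ?thesis
  proof cases
    case 1
    have "((\<lambda>t. t powr q) has_real_derivative q * sgn t * \<bar>t\<bar> powr (q - 1)) (at t)"
      using 1 by (auto intro!: derivative_eq_intros)
    then show ?thesis
      by (rule has_field_derivative_transform_within_open[where S = "{0<..}"]) (use 1 in auto)
  next
    case 2
    have "((\<lambda>t. (- t) powr q) has_real_derivative q * sgn t * \<bar>t\<bar> powr (q - 1)) (at t)"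
      using 2 by (auto intro!: derivative_eq_intros)
    then show ?thesis
      by (rule has_field_derivative_transform_within_open[where S = "{..<0}"]) (use 2 in auto)
  next
    case 3
    have "((\<lambda>y. \<bar>y\<bar> powr (q - 1)) \<longlongrightarrow> \<bar>0\<bar> powr (q - 1)) (at (0::real))"
      using assms by (intro tendsto_powr' tendsto_intros) auto
    then have lim: "((\<lambda>y. \<bar>y\<bar> powr (q - 1)) \<longlongrightarrow> 0) (at (0::real))"
      using assms by simp
    have "((\<lambda>y. \<bar>y\<bar> powr q / y) \<longlongrightarrow> 0) (at (0::real))"
    proof (rule Lim_null_comparison[OF _ lim])
      show "\<forall>\<^sub>F y in at (0::real). norm (\<bar>y\<bar> powr q / y) \<le> \<bar>y\<bar> powr (q - 1)"
        by (auto simp: eventually_at_filter powr_diff)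
    qed
    then show ?thesis
      using 3 assms by (simp add: has_field_derivative_iff)
  qed
qed

lemma gderiv_s_fun:
  fixes x :: "real ^ 'n"
  assumes "q > 1" "x \<noteq> 0"
  shows "GDERIV (s_fun p q) x :>
    (p * lr q x powr (p - q)) *\<^sub>R (\<chi> i. sgn (x $ i) * \<bar>x $ i\<bar> powr (q - 1))"
proof -
  define S where "S = (\<lambda>y::real^'n. \<Sum>i\<in>UNIV. \<bar>y $ i\<bar> powr q)"
  obtain j where j: "x $ j \<noteq> 0" using assms(2) by (auto simp: vec_eq_iff)
  have pos: "S x > 0"
    unfolding S_def by (rule sum_pos2[of _ j]) (use j in auto)
  have "((\<lambda>y::real^'n. \<bar>y $ i\<bar> powr q) has_derivative
      (\<lambda>h. (q * sgn (x $ i) * \<bar>x $ i\<bar> powr (q - 1)) * h $ i)) (at x)" for i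
    using has_derivative_compose[OF bounded_linear_imp_has_derivative[OF bounded_linear_vec_nth]
        abs_powr_has_derivative[OF assms(1), unfolded has_field_derivative_def], of i x]
    by simp
  then have dS: "(S has_derivative
      (\<lambda>h. \<Sum>i\<in>UNIV. (q * sgn (x $ i) * \<bar>x $ i\<bar> powr (q - 1)) * h $ i)) (at x)"
    unfolding S_def by (intro has_derivative_sum)
  have "((\<lambda>t. t powr (p / q)) has_real_derivative (p / q) * S x powr (p / q - 1)) (at (S x))"
    using pos by (auto intro!: derivative_eq_intros)
  from has_derivative_compose[OF dS this[unfolded has_field_derivative_def]]
  have d: "((\<lambda>y. S y powr (p / q)) has_derivative
      (\<lambda>h. (p / q) * S x powr (p / q - 1) *
        (\<Sum>i\<in>UNIV. (q * sgn (x $ i) * \<bar>x $ i\<bar> powr (q - 1)) * h $ i))) (at x)" .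
  have s: "s_fun p q = (\<lambda>y::real^'n. S y powr (p / q))"
    by (auto simp: s_fun_def lr_def S_def powr_powr)
  have l: "lr q x powr (p - q) = S x powr (p / q - 1)"
    using assms(1) by (simp add: lr_def S_def powr_powr diff_divide_distrib)
  show ?thesis
    unfolding gderiv_def s l
    by (rule has_derivative_eq_rhs[OF d])
       (use assms(1) in \<open>auto simp: inner_vec_def sum_distrib_left fun_eq_iff field_simps intro!: sum.cong\<close>)
qed

lemma gradient_s_fun:
  fixes x :: "real ^ 'n"
  assumes "q > 1" "x \<noteq> 0"
  shows "gradient (s_fun p q) x =
    (p * lr q x powr (p - q)) *\<^sub>R (\<chi> i. sgn (x $ i) * \<bar>x $ i\<bar> powr (q - 1))"
  by (rule gradient_eqI[OF gderiv_s_fun[OF assms]])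

end

theory Submission
  imports Defs
begin

text \<open>
  The origin cannot belong to \<open>U\<close>: the gradient of \<open>s\<close> is odd and homogeneous of degree
  \<open>p - 1 \<le> 0\<close>, which is incompatible with a Lipschitz bound near \<open>0\<close>. So \<open>s\<close> is differentiable on
  the convex set \<open>U\<close> and satisfies the descent inequality there. Comparing the objective of the
  subproblem at \<open>x (Suc k)\<close> and at \<open>x k\<close>, where \<open>\<alpha> k * s (x k)\<close> equals the \<open>p\<close>-th power of the
  \<open>p\<close>-norm of \<open>x k\<close>, bounds \<open>Delta\<close> from below. The power mean inequality bounds \<open>\<alpha> k\<close>, and the
  increments vanish because the decreasing nonnegative sequence \<open>\<alpha>\<close> converges.
\<close>

lemma lr_powr:
  assumes "r \<noteq> 0"
  shows "lr r x powr r = (\<Sum>i\<in>UNIV. \<bar>x $ i\<bar> powr r)"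
  using assms by (simp add: lr_def powr_powr sum_nonneg)

lemma lr_pos:
  fixes x :: "real ^ 'n"
  assumes "x \<noteq> 0"
  shows "lr r x > 0"
proof -
  obtain j where j: "x $ j \<noteq> 0" using assms by (auto simp: vec_eq_iff)
  have "(\<Sum>i\<in>UNIV. \<bar>x $ i\<bar> powr r) > 0"
    by (rule sum_pos2[of _ j]) (use j in auto)
  then show ?thesis by (simp add: lr_def)
qed

lemma lr_scaleR:
  assumes "r > 0"
  shows "lr r (t *\<^sub>R x) = \<bar>t\<bar> * lr r x"
proof -
  have "(\<Sum>i\<in>UNIV. \<bar>(t *\<^sub>R x) $ i\<bar> powr r) = \<bar>t\<bar> powr r * (\<Sum>i\<in>UNIV. \<bar>x $ i\<bar> powr r)"
    by (simp add: abs_mult powr_mult sum_distrib_left)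
  then show ?thesis
    using assms by (simp add: lr_def powr_mult powr_powr sum_nonneg)
qed

text \<open>The right-hand side is the tangent at \<open>1\<close> of the concave map
  \<open>t powr a\<close>. The bound is Young's inequality for \<open>t powr a\<close> and
  \<open>1\<close> with conjugate exponents \<open>1 / a\<close> and
  \<open>1 / (1 - a)\<close>.\<close>

lemma powr_le_affine:
  fixes a t :: real
  assumes "0 \<le> t" "0 < a" "a < 1"
  shows "t powr a \<le> a * t + (1 - a)"
proof -
  have "(t powr a) * 1 \<le> (t powr a) powr (1 / a) / (1 / a) + 1 powr (1 / (1 - a)) / (1 / (1 - a))"
    using assms by (intro Youngs_inequality) auto
  then show ?thesis using assms by (simp add: powr_powr mult.commute)
qed

text \<open>After rescaling so that the \<open>q\<close>-th powers of the entries average to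
  \<open>1\<close>, the tangent bound \<open>powr_le_affine\<close> with exponent
  \<open>p / q\<close> is summed over the entries, and its right-hand sides add up to
  \<open>n\<close>. For iterates, the factor is the bound \<open>alpha_bar\<close> on the
  ratios.\<close>

lemma lr_power_mean:
  fixes x :: "real ^ 'n"
  assumes "0 < p" "p < q"
  shows "lr p x powr p \<le> real CARD('n) powr (1 - p / q) * lr q x powr p"
proof (cases "x = 0")
  case True
  then show ?thesis using assms by (simp add: lr_def)
next
  case False
  define S where "S = lr q x powr q"
  define n where "n = real CARD('n)"
  have n: "n > 0" by (simp add: n_def)
  have S: "S > 0" "S = (\<Sum>i\<in>UNIV. \<bar>x $ i\<bar> powr q)"
    using lr_pos[OF False, of q] assms by (simp add: S_def, simp add: S_def lr_powr)
  have Sp: "S powr (p / q) = lr q x powr p"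
    using assms by (simp add: S_def powr_powr)
  \<comment> \<open>\<open>M\<close> is the common value of \<open>\<bar>x $ i\<bar> powr p\<close>
    if all entries had equal modulus and the same \<open>q\<close>-norm as \<open>x\<close>.\<close>
  define M where "M = (S / n) powr (p / q)"
  have M: "M > 0" using S n by (simp add: M_def)
  have "\<bar>x $ i\<bar> powr p / M \<le> p / q * (n * \<bar>x $ i\<bar> powr q / S) + (1 - p / q)" for i
  proof -
    have "\<bar>x $ i\<bar> powr p / M = (n * \<bar>x $ i\<bar> powr q / S) powr (p / q)"
      using assms n S(1) by (simp add: M_def powr_divide powr_mult powr_powr)
    also have "\<dots> \<le> p / q * (n * \<bar>x $ i\<bar> powr q / S) + (1 - p / q)"
      using assms n S(1) by (intro powr_le_affine) auto
    finally show ?thesis .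
  qed
  then have "(\<Sum>i\<in>UNIV. \<bar>x $ i\<bar> powr p / M)
      \<le> (\<Sum>i\<in>UNIV. p / q * (n * \<bar>x $ i\<bar> powr q / S) + (1 - p / q))"
    by (rule sum_mono)
  also have "\<dots> = p / q * (n * (\<Sum>i\<in>UNIV. \<bar>x $ i\<bar> powr q) / S) + n * (1 - p / q)"
    by (simp add: sum.distrib n_def sum_distrib_left sum_divide_distrib)
  also have "\<dots> = n"
    using S(1) by (simp add: algebra_simps flip: S(2))
  finally have "lr p x powr p / M \<le> n"
    using assms by (simp add: lr_powr sum_divide_distrib)
  then have "lr p x powr p \<le> n * M"
    using M by (simp add: field_simps)
  also have "\<dots> = n powr (1 - p / q) * lr q x powr p"
    using n S(1) by (simp add: M_def powr_divide powr_diff Sp)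
  finally show ?thesis by (simp add: n_def)
qed

text \<open>Along the segment from \<open>y\<close> to \<open>z\<close>, \<open>f\<close> minus the
  claimed lower bound is nondecreasing: by Cauchy-Schwarz and the Lipschitz bound against the base
  point \<open>y\<close>, its derivative is nonnegative.\<close>

lemma lower_quadratic_bound:
  fixes f :: "'a::real_inner \<Rightarrow> real"
  assumes "convex U" "y \<in> U" "z \<in> U"
    and grad: "\<And>w. w \<in> U \<Longrightarrow> GDERIV f w :> g w"
    and lip: "\<And>w. w \<in> U \<Longrightarrow> norm (g w - g y) \<le> L * norm (w - y)"
  shows "f z \<ge> f y + g y \<bullet> (z - y) - L / 2 * (norm (z - y))\<^sup>2"
proof -
  define d where "d = z - y"
  define \<phi> where "\<phi> t = f (y + t *\<^sub>R d) - t * (g y \<bullet> d) + L / 2 * t\<^sup>2 * (norm d)\<^sup>2" for t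
  define \<phi>' where "\<phi>' t = (g (y + t *\<^sub>R d) - g y) \<bullet> d + L * t * (norm d)\<^sup>2" for t
  have "\<phi> 0 \<le> \<phi> 1"
  proof (rule DERIV_nonneg_imp_nondecreasing[of 0 1 \<phi>])
    fix t :: real assume t: "0 \<le> t" "t \<le> 1"
    have "(1 - t) *\<^sub>R y + t *\<^sub>R z \<in> U"
      using assms t by (intro convexD_alt) auto
    then have U: "y + t *\<^sub>R d \<in> U"
      by (simp add: d_def algebra_simps)
    have "((\<lambda>t. y + t *\<^sub>R d) has_derivative (\<lambda>h. h *\<^sub>R d)) (at t)"
      by (auto intro!: derivative_eq_intros)
    from has_derivative_compose[OF this grad[OF U, unfolded gderiv_def]]
    have "((\<lambda>t. f (y + t *\<^sub>R d)) has_real_derivative g (y + t *\<^sub>R d) \<bullet> d) (at t)"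
      by (simp add: has_field_derivative_def inner_commute mult.commute[of _ "_ \<bullet> _"])
    then have "(\<phi> has_real_derivative \<phi>' t) (at t)"
      unfolding \<phi>_def \<phi>'_def
      by (auto intro!: derivative_eq_intros simp: inner_diff_left)
    moreover have "\<phi>' t \<ge> 0"
    proof -
      have "- ((g (y + t *\<^sub>R d) - g y) \<bullet> d) \<le> norm (g (y + t *\<^sub>R d) - g y) * norm d"
        using Cauchy_Schwarz_ineq2[of "g (y + t *\<^sub>R d) - g y" d] by linarith
      also have "\<dots> \<le> (L * norm (t *\<^sub>R d)) * norm d"
        using lip[OF U] by (intro mult_right_mono) auto
      also have "\<dots> = L * t * (norm d)\<^sup>2"
        using t by (simp add: power2_eq_square)
      finally show ?thesis by (simp add: \<phi>'_def)
    qed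
    ultimately show "\<exists>D. (\<phi> has_real_derivative D) (at t) \<and> D \<ge> 0" by blast
  qed simp
  then show ?thesis by (simp add: \<phi>_def d_def)
qed

text \<open>The norm factor scales by \<open>\<bar>t\<bar> powr (p - q)\<close> and each entry by
  \<open>sgn t * \<bar>t\<bar> powr (q - 1)\<close>.\<close>

lemma gradient_s_fun_scaleR:
  fixes x :: "real ^ 'n"
  assumes "q > 1" "x \<noteq> 0" "t \<noteq> 0"
  shows "gradient (s_fun p q) (t *\<^sub>R x) = (sgn t * \<bar>t\<bar> powr (p - 1)) *\<^sub>R gradient (s_fun p q) x"
proof -
  have "\<bar>t\<bar> powr (p - q) * \<bar>t\<bar> powr (q - 1) = \<bar>t\<bar> powr (p - 1)"
    by (simp flip: powr_add)
  then show ?thesis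
    using assms
    by (simp add: gradient_s_fun lr_scaleR vec_eq_iff abs_mult powr_mult sgn_mult)
qed

lemma gradient_s_fun_nonzero:
  fixes x :: "real ^ 'n"
  assumes "p \<noteq> 0" "q > 1" "x \<noteq> 0"
  shows "gradient (s_fun p q) x \<noteq> 0"
  using assms lr_pos[OF assms(3), of q]
  by (auto simp: gradient_s_fun vec_eq_iff sgn_if split: if_splits)

text \<open>Opposite points \<open>t e\<close> and \<open>-t e\<close> are at distance
  \<open>2 t\<close>, but their gradients differ by at least twice the norm of \<open>g e\<close>
  for \<open>0 < t < 1\<close>, since \<open>p - 1\<close> is not positive. Comparing these two
  points avoids the unspecified gradient at the origin.\<close>

lemma zero_notin_Lipschitz_domain:
  fixes U :: "(real ^ 'n) set"
  assumes "0 < p" "p \<le> 1" "q > 1" "open U"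
    and lip: "\<forall>y\<in>U. \<forall>z\<in>U.
      norm (gradient (s_fun p q) y - gradient (s_fun p q) z) \<le> L * norm (y - z)"
  shows "0 \<notin> U"
proof
  assume "0 \<in> U"
  define g :: "real ^ 'n \<Rightarrow> real ^ 'n" where "g = gradient (s_fun p q)"
  define e :: "real ^ 'n" where "e = axis undefined 1"
  have e: "e \<noteq> 0" "norm e = 1" by (simp_all add: e_def)
  have ge: "norm (g e) > 0"
    using gradient_s_fun_nonzero[of p q e] assms e by (simp add: g_def)
  obtain r where r: "r > 0" "ball 0 r \<subseteq> U"
    using \<open>open U\<close> \<open>0 \<in> U\<close> by (meson open_contains_ball)
  \<comment> \<open>The three bounds give \<open>t powr (p - 1) \<ge> 1\<close>, keep both points in
    the ball, and force \<open>L * t\<close> to be at most half the norm of \<open>g e\<close>.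
    Adding \<open>1\<close> to \<open>\<bar>L\<bar>\<close> keeps the denominator positive.\<close>
  define t where "t = min (1 / 2) (min (r / 2) (norm (g e) / (2 * (\<bar>L\<bar> + 1))))"
  have t: "t > 0" "t < 1" "t < r" "t \<le> norm (g e) / (2 * (\<bar>L\<bar> + 1))"
    using r ge by (auto simp: t_def)
  have "t *\<^sub>R e \<in> ball 0 r" "(- t) *\<^sub>R e \<in> ball 0 r"
    using e t by (simp_all add: dist_norm)
  then have "t *\<^sub>R e \<in> U" "(- t) *\<^sub>R e \<in> U" using r by blast+
  then have "norm (g (t *\<^sub>R e) - g ((- t) *\<^sub>R e)) \<le> L * norm (t *\<^sub>R e - (- t) *\<^sub>R e)"
    using lip unfolding g_def by blast
  also have "g (t *\<^sub>R e) - g ((- t) *\<^sub>R e) = (2 * t powr (p - 1)) *\<^sub>R g e"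
    using gradient_s_fun_scaleR[of q e t p] gradient_s_fun_scaleR[of q e "- t" p] assms e t
    by (simp add: g_def scaleR_2 flip: scaleR_scaleR)
  also have "t *\<^sub>R e - (- t) *\<^sub>R e = (2 * t) *\<^sub>R e"
    by (simp add: scaleR_2 flip: scaleR_scaleR)
  finally have *: "t powr (p - 1) * norm (g e) \<le> L * t"
    using e t by simp
  have "t powr 0 \<le> t powr (p - 1)"
    using t assms by (intro powr_mono') auto
  then have "1 * norm (g e) \<le> t powr (p - 1) * norm (g e)"
    using t by (intro mult_right_mono) auto
  also note *
  also have "L * t \<le> \<bar>L\<bar> * t" using t by (intro mult_right_mono) auto
  also have "\<dots> \<le> (\<bar>L\<bar> + 1) * t" using t by (intro mult_right_mono) auto
  also have "\<dots> \<le> (\<bar>L\<bar> + 1) * (norm (g e) / (2 * (\<bar>L\<bar> + 1)))"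
    using t by (intro mult_left_mono) auto
  also have "\<dots> = norm (g e) / 2"
    by (simp add: field_simps)
  finally show False using ge by simp
qed

text \<open>A nonempty open set is not a singleton, so the bound can be tested on two distinct
  points. The sign is what lets a bound on \<open>\<alpha> k\<close> be multiplied by
  \<open>Ls\<close>.\<close>

lemma Lipschitz_constant_nonneg:
  fixes U :: "'a::euclidean_space set" and g :: "'a \<Rightarrow> 'b::real_normed_vector"
  assumes "open U" "y \<in> U"
    and lip: "\<forall>y\<in>U. \<forall>z\<in>U. norm (g y - g z) \<le> L * norm (y - z)"
  shows "L \<ge> 0"
proof -
  have "U \<noteq> {y}"
    using \<open>open U\<close> not_open_singleton by metis
  then obtain z where "z \<in> U" "z \<noteq> y" using \<open>y \<in> U\<close> by blast
  then have "0 \<le> L * norm (z - y)"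
    using lip \<open>y \<in> U\<close> norm_ge_zero order_trans by meson
  then show ?thesis using \<open>z \<noteq> y\<close> by (simp add: zero_le_mult_iff)
qed

text \<open>This turns comparisons of extended-real objectives at iterates into real
  inequalities.\<close>

lemma subproblem_feasible:
  assumes "z \<in> feasible A b"
  shows "subproblem A b p \<beta> c y z = ereal (lr p z powr p - c \<bullet> z + \<beta> / 2 * (norm (z - y))\<^sup>2)"
  using assms by (simp add: subproblem_def h_fun_def indicator_fun_def)

lemma prox_linear_dinkelbach_ratio:
  assumes "prox_linear_dinkelbach A b p q \<beta> x \<alpha>"
  shows "\<alpha> k = lr p (x k) powr p / lr q (x k) powr p"
  using assms by (cases k) (auto simp: prox_linear_dinkelbach_def)

theorem theorem7p8:
  fixes A :: "real ^ 'n ^ 'm" and b :: "real ^ 'm"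
    and p q \<beta> Ls \<nu> :: real
    and x :: "nat \<Rightarrow> real ^ 'n" and \<alpha> :: "nat \<Rightarrow> real"
    and \<Omega> U :: "(real ^ 'n) set"
  assumes beta_pos: "\<beta> > 0"
    and scheme: "prox_linear_dinkelbach A b p q \<beta> x \<alpha>"
    and i: "feasible A b \<noteq> {}" "0 < p" "p \<le> 1" "q > 1" "b \<noteq> 0" "rank A = CARD('m)"
    and ii: "bounded (range x)"
    and iii: "compact \<Omega>" "open U" "convex U" "\<Omega> \<subseteq> U" "\<forall>k. x k \<in> \<Omega> \<inter> feasible A b"
      "\<forall>y\<in>U. \<forall>z\<in>U. norm (gradient (s_fun p q) y - gradient (s_fun p q) z) \<le> Ls * norm (y - z)"
    and iv: "\<beta> > alpha_bar CARD('n) p q * Ls"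
    and nu: "\<forall>y\<in>\<Omega> \<inter> feasible A b. lr q y powr p \<le> \<nu>"
  shows "(\<forall>k. Delta p q x \<alpha> k \<ge> (\<beta> - \<alpha> k * Ls) / 2 * (norm (x (Suc k) - x k))\<^sup>2 \<and>
              (\<beta> - \<alpha> k * Ls) / 2 * (norm (x (Suc k) - x k))\<^sup>2
                \<ge> (\<beta> - alpha_bar CARD('n) p q * Ls) / 2 * (norm (x (Suc k) - x k))\<^sup>2 \<and>
              (\<beta> - alpha_bar CARD('n) p q * Ls) / 2 * (norm (x (Suc k) - x k))\<^sup>2 \<ge> 0) \<and>
         (\<forall>k. \<alpha> k - \<alpha> (Suc k) = Delta p q x \<alpha> k / lr q (x (Suc k)) powr p \<and>
              Delta p q x \<alpha> k / lr q (x (Suc k)) powr p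
                \<ge> (\<beta> - alpha_bar CARD('n) p q * Ls) / (2 * \<nu>) * (norm (x (Suc k) - x k))\<^sup>2) \<and>
         (\<forall>k. \<alpha> (Suc k) \<le> \<alpha> k) \<and> convergent \<alpha> \<and>
         (\<lambda>k. norm (x (Suc k) - x k)) \<longlonglongrightarrow> 0"
proof -
  define g :: "real ^ 'n \<Rightarrow> real ^ 'n" where "g = gradient (s_fun p q)"
  define D where "D k = (norm (x (Suc k) - x k))\<^sup>2" for k
  define \<gamma> where "\<gamma> = \<beta> - alpha_bar CARD('n) p q * Ls"
  have \<gamma>: "\<gamma> > 0" using iv by (simp add: \<gamma>_def)
  have D: "D k \<ge> 0" for k by (simp add: D_def)
  have feas: "x k \<in> feasible A b" and xU: "x k \<in> U" for k
    using iii by blast+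
  \<comment> \<open>Since \<open>b\<close> is nonzero, the origin is infeasible, so every ratio has
    a positive denominator.\<close>
  have x0: "x k \<noteq> 0" for k
    using feas[of k] i(5) by (auto simp: feasible_def)
  have s_pos: "lr q (x k) powr p > 0" for k
    using lr_pos[OF x0] by (metis less_irrefl powr_gt_zero)
  have s_le: "lr q (x k) powr p \<le> \<nu>" for k
    using nu iii(5) by blast
  have \<nu>: "\<nu> > 0" using s_pos[of 0] s_le[of 0] by linarith
  have U0: "0 \<notin> U"
    by (rule zero_notin_Lipschitz_domain[OF i(2-4) iii(2,6)])
  have L: "Ls \<ge> 0"
    by (rule Lipschitz_constant_nonneg[OF iii(2) xU[of 0] iii(6)])
  have \<alpha>: "\<alpha> k = lr p (x k) powr p / lr q (x k) powr p" for k
    by (rule prox_linear_dinkelbach_ratio[OF scheme])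
  have \<alpha>s: "\<alpha> k * lr q (x k) powr p = lr p (x k) powr p" for k
    using s_pos[of k] by (simp add: \<alpha>)
  have \<alpha>0: "\<alpha> k \<ge> 0" for k by (simp add: \<alpha>)
  have \<alpha>_le: "\<alpha> k \<le> alpha_bar CARD('n) p q" for k
    using lr_power_mean[of p q "x k"] i s_pos[of k]
    by (simp add: \<alpha> alpha_bar_def pos_divide_le_eq)
  \<comment> \<open>Because \<open>U\<close> avoids the origin, the definite description in
    \<open>gradient\<close> denotes the true gradient throughout \<open>U\<close>.\<close>
  have grad: "GDERIV (s_fun p q) w :> g w" if "w \<in> U" for w
    using that U0 gderiv_s_fun[of q w p] gradient_s_fun[of q w p] i(4) by (metis g_def)
  have descent: "(\<beta> - \<alpha> k * Ls) / 2 * D k \<le> Delta p q x \<alpha> k" for k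
  proof -
    let ?c = "c_vec p q x \<alpha> k"
    have "s_fun p q (x (Suc k)) \<ge>
        s_fun p q (x k) + g (x k) \<bullet> (x (Suc k) - x k) - Ls / 2 * (norm (x (Suc k) - x k))\<^sup>2"
      using iii(6) by (intro lower_quadratic_bound[OF iii(3) xU xU grad]) (auto simp: g_def xU)
    then have "\<alpha> k * (lr q (x k) powr p + g (x k) \<bullet> (x (Suc k) - x k) - Ls / 2 * D k)
        \<le> \<alpha> k * lr q (x (Suc k)) powr p"
      using \<alpha>0 by (intro mult_left_mono) (auto simp: s_fun_def D_def)
    \<comment> \<open>The ratio identity \<open>\<alpha>s\<close> replaces the scaled value of
      \<open>s\<close> at \<open>x k\<close> by the \<open>p\<close>-th power term, which then
      cancels against the subproblem comparison.\<close>
    then have 1: "lr p (x k) powr p + ?c \<bullet> (x (Suc k) - x k) - \<alpha> k * Ls / 2 * D k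
        \<le> \<alpha> k * lr q (x (Suc k)) powr p"
      by (simp add: c_vec_def g_def algebra_simps \<alpha>s)
    \<comment> \<open>The competitor is the previous iterate, where the proximal term
      vanishes.\<close>
    have "subproblem A b p \<beta> ?c (x k) (x (Suc k)) \<le> subproblem A b p \<beta> ?c (x k) (x k)"
      using scheme unfolding prox_linear_dinkelbach_def is_arg_min_def by (meson not_less)
    then have "lr p (x (Suc k)) powr p - ?c \<bullet> x (Suc k) + \<beta> / 2 * D k
        \<le> lr p (x k) powr p - ?c \<bullet> x k"
      by (simp add: subproblem_feasible feas D_def)
    with 1 show ?thesis
      by (simp add: Delta_def inner_diff_right algebra_simps diff_divide_distrib)
  qed
  have mid: "\<gamma> / 2 * D k \<le> (\<beta> - \<alpha> k * Ls) / 2 * D k" for k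
    using mult_right_mono[OF \<alpha>_le[of k] L] D by (intro mult_right_mono) (auto simp: \<gamma>_def)
  have low: "0 \<le> \<gamma> / 2 * D k" for k
    using \<gamma> D by simp
  have diff: "\<alpha> k - \<alpha> (Suc k) = Delta p q x \<alpha> k / lr q (x (Suc k)) powr p" for k
    using s_pos[of "Suc k"] by (simp add: \<alpha>[of "Suc k"] Delta_def diff_divide_distrib)
  have dec: "\<gamma> / (2 * \<nu>) * D k \<le> Delta p q x \<alpha> k / lr q (x (Suc k)) powr p" for k
  proof -
    have "\<gamma> / (2 * \<nu>) * D k = (\<gamma> / 2 * D k) / \<nu>" by simp
    \<comment> \<open>The numerator is nonnegative, so shrinking the denominator from
      \<open>\<nu>\<close> to the actual value of \<open>s\<close> can only increase the
      quotient.\<close>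
    also have "\<dots> \<le> (\<gamma> / 2 * D k) / lr q (x (Suc k)) powr p"
      using low s_pos s_le \<nu> by (intro divide_left_mono) auto
    also have "\<dots> \<le> Delta p q x \<alpha> k / lr q (x (Suc k)) powr p"
      using mid[of k] descent[of k] s_pos[of "Suc k"] by (intro divide_right_mono) auto
    finally show ?thesis .
  qed
  have mono: "\<alpha> (Suc k) \<le> \<alpha> k" for k
  proof -
    have "0 \<le> \<gamma> / (2 * \<nu>) * D k" using \<gamma> \<nu> D by simp
    then show ?thesis using dec[of k] diff[of k] by linarith
  qed
  then have "decseq \<alpha>" by (simp add: decseq_Suc_iff)
  then obtain l where l: "\<alpha> \<longlonglongrightarrow> l"
    using decseq_convergent[of \<alpha> 0] \<alpha>0 by blast
  have "(\<lambda>k. \<alpha> k - \<alpha> (Suc k)) \<longlonglongrightarrow> l - l"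
    by (intro tendsto_diff l LIMSEQ_Suc)
  then have "(\<lambda>k. 2 * \<nu> / \<gamma> * (\<alpha> k - \<alpha> (Suc k))) \<longlonglongrightarrow> 0"
    using tendsto_mult_right_zero by fastforce
  \<comment> \<open>Solving the decrease estimate for \<open>D k\<close> squeezes it between
    \<open>0\<close> and a multiple of consecutive differences of the convergent sequence
    \<open>\<alpha>\<close>.\<close>
  moreover have "D k \<le> 2 * \<nu> / \<gamma> * (\<alpha> k - \<alpha> (Suc k))" for k
    using dec[of k] \<gamma> \<nu> by (simp add: field_simps flip: diff)
  ultimately have "D \<longlonglongrightarrow> 0"
    by (intro tendsto_sandwich[of "\<lambda>_. 0" D sequentially]) (auto simp: D)
  then have "(\<lambda>k. sqrt (D k)) \<longlonglongrightarrow> 0"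
    using tendsto_real_sqrt by fastforce
  then have "(\<lambda>k. norm (x (Suc k) - x k)) \<longlonglongrightarrow> 0"
    by (simp add: D_def)
  moreover have "convergent \<alpha>" using l by (rule convergentI)
  ultimately show ?thesis
    using descent mid low diff dec mono unfolding D_def \<gamma>_def by blast
qed

end
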